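(* Let $X=(X_t)_{t\in\mathbb R}$ be a splittable stationary random process, and let $\sigma\in[0,\infty)$ be the number such that for every compactly supported continuous $g:\mathbb R\to\mathbb R$, $$\lim_{r\to\infty,\ \lambda\to0,\ \lambda\log r\to0}\frac1{r\lambda^2}\ln\mathbb E\exp\Big(\lambda\int_{-\infty}^\infty g\Big(\frac tr\Big)X_t\,dt\Big)=\frac{\sigma^2}2\|g\|^2_{L_2(\mathbb R)}$$ (such a number exists). Assume $\sigma\neq0$, and let $f:\mathbb R\to\mathbb R$ be a compactly supported continuous function. Then $$\lim_{r\to\infty,\ c\to\infty,\ (c\log r)^2/r\to0}\ \frac1{c^2}\ln\mathbb P\Big(\int f\Big(\frac tr\Big)X_t\,dt\ \ge\ c\,\sigma\,\|f\|_{L_2(\mathbb R)}\sqrt r\Big)=-\frac12 .$$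
   Context: A random process is a (jointly) measurable map $X:\mathbb R\times\Omega\to\mathbb R$ on a probability space; two such maps that agree almost surely at every $t\in\mathbb R$ are identified. Processes (possibly on different probability spaces) are identically distributed if they have the same finite-dimensional distributions; processes on the same probability space are independent if all their finite-dimensional vectors are independent. $X$ is stationary if for every $s\in\mathbb R$ the shifted process $(X_{s+t})_t$ is distributed like $X$. A stationary random process $X$ is *splittable* if $\mathbb E\exp|X_0|<\infty$, $\mathbb E X_0=0$, and there exists (on some probability space) a triple of random processes $X^0,X^-,X^+$ such that: (a) $X^-$ and $X^+$ are independent; (b) the four processes $X,X^0,X^-,X^+$ are identically distributed; (c) $\mathbb E\exp\big(\int_{-\infty}^0|X^-_t-X^0_t|\,dt+\int_0^\infty|X^+_t-X^0_t|\,dt\big)<\infty$. The first limit means: for every $\varepsilon>0$ there exist $R$ and $\delta>0$ such that the expression is within $\varepsilon$ of the right-hand side for all $r\ge R$ and all $\lambda\ne0$ with $|\lambda|\log r\le\delta$. The second limit is a joint limit, i.e. it holds along all sequences $(r_n,c_n)$ with $r_n\to\infty$, $c_n\to\infty$, $(c_n\log r_n)^2/r_n\to0$.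
   Formalization: The function f is additionally assumed not to be identically zero; for f = 0 the event is {0 ≥ 0}, its probability is 1 and the limit is 0 instead of −1/2. *)

theory Defs
  imports "HOL-Probability.Probability"
begin

definition random_process :: "'w measure \<Rightarrow> (real \<Rightarrow> 'w \<Rightarrow> real) \<Rightarrow> bool" where
  "random_process M X \<longleftrightarrow>
     prob_space M \<and> (\<lambda>(t, \<omega>). X t \<omega>) \<in> borel_measurable (borel \<Otimes>\<^sub>M M)"

definition fin_dim_distr ::
  "'w measure \<Rightarrow> (real \<Rightarrow> 'w \<Rightarrow> real) \<Rightarrow> real set \<Rightarrow> (real \<Rightarrow> real) measure" where
  "fin_dim_distr M X J = distr M (Pi\<^sub>M J (\<lambda>_. borel)) (\<lambda>\<omega>. \<lambda>t\<in>J. X t \<omega>)"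

definition identically_distributed ::
  "'w measure \<Rightarrow> (real \<Rightarrow> 'w \<Rightarrow> real) \<Rightarrow> 'v measure \<Rightarrow> (real \<Rightarrow> 'v \<Rightarrow> real) \<Rightarrow> bool" where
  "identically_distributed M X N Y \<longleftrightarrow>
     (\<forall>J. finite J \<longrightarrow> fin_dim_distr M X J = fin_dim_distr N Y J)"

definition independent_processes ::
  "'w measure \<Rightarrow> (real \<Rightarrow> 'w \<Rightarrow> real) \<Rightarrow> (real \<Rightarrow> 'w \<Rightarrow> real) \<Rightarrow> bool" where
  "independent_processes M X Y \<longleftrightarrow>
     (\<forall>J K. finite J \<longrightarrow> finite K \<longrightarrow>
        prob_space.indep_var M
          (Pi\<^sub>M J (\<lambda>_. borel)) (\<lambda>\<omega>. \<lambda>t\<in>J. X t \<omega>)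
          (Pi\<^sub>M K (\<lambda>_. borel)) (\<lambda>\<omega>. \<lambda>t\<in>K. Y t \<omega>))"

definition stationary :: "'w measure \<Rightarrow> (real \<Rightarrow> 'w \<Rightarrow> real) \<Rightarrow> bool" where
  "stationary M X \<longleftrightarrow> (\<forall>s. identically_distributed M (\<lambda>t. X (s + t)) M X)"

definition exp_ennreal :: "ennreal \<Rightarrow> ennreal" where
  "exp_ennreal x = (if x = \<infinity> then \<infinity> else ennreal (exp (enn2real x)))"

text \<open>
  The splitting triple may live on another probability space. Its sample type \<open>'v\<close> is a
  parameter of the definition; in an assumption of a theorem a free \<open>'v\<close> amounts to
  ``on some probability space'', because the theorem then holds for every sample type.
  The extended exponential makes the last condition fail when the inner integrals are
  infinite with positive probability.
\<close>

definition splittable ::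
  "'v itself \<Rightarrow> 'w measure \<Rightarrow> (real \<Rightarrow> 'w \<Rightarrow> real) \<Rightarrow> bool" where
  "splittable (_ :: 'v itself) M X \<longleftrightarrow>
     random_process M X \<and> stationary M X \<and>
     integrable M (\<lambda>\<omega>. exp \<bar>X 0 \<omega>\<bar>) \<and>
     (LINT \<omega>|M. X 0 \<omega>) = 0 \<and>
     (\<exists>(N :: 'v measure) X0 Xm Xp.
        random_process N X0 \<and> random_process N Xm \<and> random_process N Xp \<and>
        independent_processes N Xm Xp \<and>
        identically_distributed M X N X0 \<and>
        identically_distributed M X N Xm \<and>
        identically_distributed M X N Xp \<and>
        (\<integral>\<^sup>+\<omega>. exp_ennreal
             ((\<integral>\<^sup>+t\<in>{..0}. ennreal \<bar>Xm t \<omega> - X0 t \<omega>\<bar> \<partial>lborel)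
            + (\<integral>\<^sup>+t\<in>{0..}. ennreal \<bar>Xp t \<omega> - X0 t \<omega>\<bar> \<partial>lborel)) \<partial>N) < \<infinity>)"

definition compactly_supported :: "(real \<Rightarrow> real) \<Rightarrow> bool" where
  "compactly_supported g \<longleftrightarrow> compact (closure {t. g t \<noteq> 0})"

definition L2_norm :: "(real \<Rightarrow> real) \<Rightarrow> real" where
  "L2_norm g = sqrt (LINT t|lborel. (g t)\<^sup>2)"

definition scaled_integral ::
  "(real \<Rightarrow> 'w \<Rightarrow> real) \<Rightarrow> (real \<Rightarrow> real) \<Rightarrow> real \<Rightarrow> 'w \<Rightarrow> real" where
  "scaled_integral X g r \<omega> = (LINT t|lborel. g (t / r) * X t \<omega>)"

text \<open>
  Integrability is part of the following definition because the Bochner integral and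
  \<open>ln\<close> are total: an infinite exponential moment would otherwise be read as
  \<open>ln 0 = 0\<close>.
\<close>

definition log_mgf_limit ::
  "'w measure \<Rightarrow> (real \<Rightarrow> 'w \<Rightarrow> real) \<Rightarrow> (real \<Rightarrow> real) \<Rightarrow> real \<Rightarrow> bool" where
  "log_mgf_limit M X g L \<longleftrightarrow>
     (\<forall>\<epsilon>>0. \<exists>R. \<exists>\<delta>>0. \<forall>r \<theta>. r > 0 \<longrightarrow> r \<ge> R \<longrightarrow> \<theta> \<noteq> 0 \<longrightarrow> \<bar>\<theta>\<bar> * ln r \<le> \<delta> \<longrightarrow>
        integrable M (\<lambda>\<omega>. exp (\<theta> * scaled_integral X g r \<omega>)) \<and>
        \<bar>1 / (r * \<theta>\<^sup>2) * ln (LINT \<omega>|M. exp (\<theta> * scaled_integral X g r \<omega>)) - L\<bar> < \<epsilon>)"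

end

theory Submission
  imports Defs
begin

text \<open>
  Write \<open>s = \<sigma> \<parallel>f\<parallel>\<close> and let \<open>Z\<^sub>n\<close> be the integral of \<open>f (t / r\<^sub>n) X\<^sub>t\<close> divided by \<open>s \<surd>r\<^sub>n\<close>. The hypothesis
  on \<open>r\<^sub>n\<close> and \<open>c\<^sub>n\<close> says exactly that, for each fixed \<open>u\<close>, the parameter \<open>\<theta>\<^sub>n = u c\<^sub>n / (s \<surd>r\<^sub>n)\<close> is
  admissible in the asymptotics of the logarithmic moment generating function. This yields
  \<open>ln E exp (u c\<^sub>n Z\<^sub>n) \<sim> c\<^sub>n\<^sup>2 u\<^sup>2 / 2\<close>, the Gaussian behaviour, and the tail asymptotics follow by the
  one-dimensional Gaertner--Ellis argument (\<open>tail_of_quadratic_log_mgf\<close>).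

  The upper bound of that argument is Chernoff's inequality with \<open>u = 1\<close>. For the lower bound,
  \<open>E exp (u c\<^sub>n Z\<^sub>n)\<close> with \<open>u\<close> slightly larger than 1 is dominated by values of \<open>Z\<^sub>n\<close> close to
  \<open>u c\<^sub>n\<close>: the contribution of the values below \<open>c\<^sub>n\<close> and of those above \<open>(2 u - 1) c\<^sub>n\<close> is
  exponentially smaller, by the known moment generating function at the neighbouring parameters 1
  and \<open>2 u - 1\<close>. Hence \<open>Z\<^sub>n \<ge> c\<^sub>n\<close> must carry the bulk of the tilted mass, which bounds its probability
  from below.
\<close>

section \<open>Tails from quadratic logarithmic moment generating functions\<close>

lemma exp_bounds_of_log_limit:
  fixes a q :: "nat \<Rightarrow> real"
  assumes lim: "(\<lambda>n. ln (a n) / q n) \<longlonglongrightarrow> L"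
    and q: "filterlim q at_top sequentially"
    and pos: "\<forall>\<^sub>F n in sequentially. a n > 0"
    and "\<epsilon> > 0"
  shows "\<forall>\<^sub>F n in sequentially. exp (q n * (L - \<epsilon>)) \<le> a n \<and> a n \<le> exp (q n * (L + \<epsilon>))"
proof -
  have "\<forall>\<^sub>F n in sequentially. dist (ln (a n) / q n) L < \<epsilon>"
    using lim \<open>\<epsilon> > 0\<close> by (rule tendstoD)
  moreover have "\<forall>\<^sub>F n in sequentially. q n > 0"
    using q by (simp add: filterlim_at_top_dense)
  ultimately show ?thesis
    using pos
  proof eventually_elim
    case (elim n)
    then have "L - \<epsilon> < ln (a n) / q n" "ln (a n) / q n < L + \<epsilon>"
      by (auto simp: dist_real_def abs_less_iff)
    with elim have "q n * (L - \<epsilon>) < ln (a n)" "ln (a n) < q n * (L + \<epsilon>)"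
      by (auto simp: field_simps)
    with elim show ?case
      by (metis exp_le_cancel_iff exp_ln less_imp_le)
  qed
qed

text \<open>
  The first summand wins for \<open>z\<close> in the window from \<open>c\<close> to \<open>(1 + 2 \<delta>) c\<close>; to the left and to the right of
  the window the exponential is compared with one of slope changed by \<open>\<delta> c\<close> that meets it at the
  respective endpoint.
\<close>

lemma exp_tilt_window_bound:
  fixes c z \<delta> :: real
  assumes "c > 0" "\<delta> > 0"
  shows "exp ((1 + \<delta>) * c * z) \<le> exp (c\<^sup>2 * ((1 + \<delta>) * (1 + 2 * \<delta>))) * (if c \<le> z then 1 else 0)
    + exp (c\<^sup>2 * \<delta>) * exp (1 * c * z)
    + exp (- (c\<^sup>2 * (\<delta> * (1 + 2 * \<delta>)))) * exp ((1 + 2 * \<delta>) * c * z)"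
proof -
  consider "z < c" | "c \<le> z" "z \<le> (1 + 2 * \<delta>) * c" | "(1 + 2 * \<delta>) * c < z"
    by linarith
  then show ?thesis
  proof cases
    case 1
    have "\<delta> * c * z \<le> \<delta> * c * c"
      using 1 assms by (intro mult_left_mono) auto
    then have "exp ((1 + \<delta>) * c * z) \<le> exp (c\<^sup>2 * \<delta>) * exp (1 * c * z)"
      by (simp add: exp_add [symmetric] algebra_simps power2_eq_square)
    then show ?thesis
      by (smt (verit) exp_gt_zero mult_nonneg_nonneg)
  next
    case 2
    have "(1 + \<delta>) * c * z \<le> (1 + \<delta>) * c * ((1 + 2 * \<delta>) * c)"
      using 2 assms by (intro mult_left_mono) auto
    also have "\<dots> = c\<^sup>2 * ((1 + \<delta>) * (1 + 2 * \<delta>))"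
      by (simp add: power2_eq_square)
    finally have "exp ((1 + \<delta>) * c * z)
        \<le> exp (c\<^sup>2 * ((1 + \<delta>) * (1 + 2 * \<delta>))) * (if c \<le> z then 1 else 0)"
      using 2 by simp
    moreover have "0 \<le> exp (c\<^sup>2 * \<delta>) * exp (1 * c * z)"
      "0 \<le> exp (- (c\<^sup>2 * (\<delta> * (1 + 2 * \<delta>)))) * exp ((1 + 2 * \<delta>) * c * z)"
      by simp_all
    ultimately show ?thesis
      by linarith
  next
    case 3
    have "\<delta> * c * ((1 + 2 * \<delta>) * c) \<le> \<delta> * c * z"
      using 3 assms by (intro mult_left_mono) auto
    then have "(1 + \<delta>) * c * z \<le> - (c\<^sup>2 * (\<delta> * (1 + 2 * \<delta>))) + (1 + 2 * \<delta>) * c * z"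
      by (simp add: algebra_simps power2_eq_square)
    then have "exp ((1 + \<delta>) * c * z)
        \<le> exp (- (c\<^sup>2 * (\<delta> * (1 + 2 * \<delta>)))) * exp ((1 + 2 * \<delta>) * c * z)"
      by (simp add: exp_add [symmetric])
    then show ?thesis
      by (smt (verit) exp_gt_zero mult_nonneg_nonneg)
  qed
qed

context prob_space
begin

lemma expectation_exp_pos:
  assumes "integrable M (\<lambda>\<omega>. exp (g \<omega> :: real))"
  shows "expectation (\<lambda>\<omega>. exp (g \<omega>)) > 0"
  using integral_less_AE_space [of "\<lambda>_. 0" "\<lambda>\<omega>. exp (g \<omega>)"] assms emeasure_space_1 by simp

text \<open>
  The factor 1 in the exponent is the parameter \<open>u = 1\<close> of the family \<open>exp (u c Z)\<close>. It optimises
  \<open>u\<^sup>2 / 2 - u\<close>, the rate that Chernoff's inequality gives for a general \<open>u\<close>.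
\<close>

lemma chernoff_at_level:
  fixes Z :: "'a \<Rightarrow> real"
  assumes [measurable]: "Z \<in> borel_measurable M"
    and "c > 0" and int: "integrable M (\<lambda>\<omega>. exp (1 * c * Z \<omega>))"
  shows "prob {\<omega> \<in> space M. c \<le> Z \<omega>} \<le> exp (- c\<^sup>2) * expectation (\<lambda>\<omega>. exp (1 * c * Z \<omega>))"
proof -
  have "prob {\<omega> \<in> space M. c \<le> Z \<omega>} = prob {\<omega> \<in> space M. exp (c\<^sup>2) \<le> exp (1 * c * Z \<omega>)}"
    using \<open>c > 0\<close> by (simp add: power2_eq_square)
  also have "\<dots> \<le> expectation (\<lambda>\<omega>. exp (1 * c * Z \<omega>)) / exp (c\<^sup>2)"
    using int by (intro integral_Markov_inequality_measure [where A = "{}"]) auto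
  finally show ?thesis
    by (simp add: exp_minus field_simps)
qed

lemma expectation_tilt_window_bound:
  fixes Z :: "'a \<Rightarrow> real"
  assumes [measurable]: "Z \<in> borel_measurable M"
    and "c > 0" "\<delta> > 0"
    and int: "integrable M (\<lambda>\<omega>. exp (1 * c * Z \<omega>))"
      "integrable M (\<lambda>\<omega>. exp ((1 + \<delta>) * c * Z \<omega>))"
      "integrable M (\<lambda>\<omega>. exp ((1 + 2 * \<delta>) * c * Z \<omega>))"
  shows "expectation (\<lambda>\<omega>. exp ((1 + \<delta>) * c * Z \<omega>))
    \<le> exp (c\<^sup>2 * ((1 + \<delta>) * (1 + 2 * \<delta>))) * prob {\<omega> \<in> space M. c \<le> Z \<omega>}
    + exp (c\<^sup>2 * \<delta>) * expectation (\<lambda>\<omega>. exp (1 * c * Z \<omega>))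
    + exp (- (c\<^sup>2 * (\<delta> * (1 + 2 * \<delta>)))) * expectation (\<lambda>\<omega>. exp ((1 + 2 * \<delta>) * c * Z \<omega>))"
    (is "?l \<le> ?a * ?P + ?b * ?E1 + ?d * ?E2")
proof -
  let ?I = "indicat_real {\<omega> \<in> space M. c \<le> Z \<omega>}"
  have I: "integrable M ?I"
    by (rule integrable_real_indicator) (auto simp: emeasure_eq_measure)
  have "?l \<le> expectation (\<lambda>\<omega>. ?a * ?I \<omega> + ?b * exp (1 * c * Z \<omega>) + ?d * exp ((1 + 2 * \<delta>) * c * Z \<omega>))"
  proof (rule integral_mono)
    fix \<omega> assume "\<omega> \<in> space M"
    then have "?I \<omega> = (if c \<le> Z \<omega> then 1 else 0)"
      by simp
    then show "exp ((1 + \<delta>) * c * Z \<omega>)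
        \<le> ?a * ?I \<omega> + ?b * exp (1 * c * Z \<omega>) + ?d * exp ((1 + 2 * \<delta>) * c * Z \<omega>)"
      using exp_tilt_window_bound [OF \<open>c > 0\<close> \<open>\<delta> > 0\<close>, of "Z \<omega>"] by (simp only:)
  qed (intro int I Bochner_Integration.integrable_add integrable_mult_right)+
  also have "\<dots> = ?a * ?P + ?b * ?E1 + ?d * ?E2"
    using I int
    by simp
  finally show ?thesis .
qed

text \<open>
  The two error terms in \<open>expectation_tilt_window_bound\<close> have exponential rate \<open>1/2 + \<delta>\<close>, while
  the left-hand side has the rate \<open>(1 + \<delta>)\<^sup>2 / 2 = 1/2 + \<delta> + \<delta>\<^sup>2 / 2\<close>; the gap \<open>\<delta>\<^sup>2 / 2\<close> forces the tail
  probability to account for at least half of it. Rates are controlled up to \<open>\<delta>\<^sup>2 / 8\<close>, which leaves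
  the room \<open>\<delta>\<^sup>2 / 4\<close> in the gap. Dividing by the exponential weight of the window gives the rate
  \<open>(1 + \<delta>)\<^sup>2 / 2 - (1 + \<delta>) (1 + 2 \<delta>) = - 1/2 - 2 \<delta> - 3 \<delta>\<^sup>2 / 2\<close>, and the \<open>2 \<delta>\<^sup>2\<close> of the statement
  covers the losses \<open>\<delta>\<^sup>2 / 8\<close> from the rate control and \<open>\<delta>\<^sup>2 / 4\<close> from the factor one half.
\<close>

lemma tail_lower_bound_of_quadratic_log_mgf:
  fixes Z :: "nat \<Rightarrow> 'a \<Rightarrow> real" and c :: "nat \<Rightarrow> real"
  assumes meas: "\<And>n. Z n \<in> borel_measurable M"
    and c: "filterlim c at_top sequentially"
    and int: "\<And>u. u > 0 \<Longrightarrow> \<forall>\<^sub>F n in sequentially. integrable M (\<lambda>\<omega>. exp (u * c n * Z n \<omega>))"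
    and lim: "\<And>u. u > 0 \<Longrightarrow>
      (\<lambda>n. ln (expectation (\<lambda>\<omega>. exp (u * c n * Z n \<omega>))) / (c n)\<^sup>2) \<longlonglongrightarrow> u\<^sup>2 / 2"
    and "\<delta> > 0"
  shows "\<forall>\<^sub>F n in sequentially.
    exp ((c n)\<^sup>2 * (- 1 / 2 - 2 * \<delta> - 2 * \<delta>\<^sup>2)) \<le> prob {\<omega> \<in> space M. c n \<le> Z n \<omega>}"
proof -
  have q: "filterlim (\<lambda>n. (c n)\<^sup>2) at_top sequentially"
    using c by (intro filterlim_pow_at_top) auto
  define E where "E u n = expectation (\<lambda>\<omega>. exp (u * c n * Z n \<omega>))" for u n
  have E: "\<forall>\<^sub>F n in sequentially. exp ((c n)\<^sup>2 * (u\<^sup>2 / 2 - \<delta>\<^sup>2 / 8)) \<le> E u n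
      \<and> E u n \<le> exp ((c n)\<^sup>2 * (u\<^sup>2 / 2 + \<delta>\<^sup>2 / 8))" if "u > 0" for u
  proof (rule exp_bounds_of_log_limit)
    show "(\<lambda>n. ln (E u n) / (c n)\<^sup>2) \<longlonglongrightarrow> u\<^sup>2 / 2"
      unfolding E_def using lim that by simp
    show "\<forall>\<^sub>F n in sequentially. E u n > 0"
      using int [OF that] by eventually_elim (simp add: E_def expectation_exp_pos)
  qed (use q \<open>\<delta> > 0\<close> in auto)
  have big: "\<forall>\<^sub>F n in sequentially. ln 4 / (\<delta>\<^sup>2 / 4) \<le> (c n)\<^sup>2"
    using q by (simp add: filterlim_at_top)
  have cpos: "\<forall>\<^sub>F n in sequentially. c n > 0"
    using c by (simp add: filterlim_at_top_dense)
  have u: "(1::real) > 0" "1 + \<delta> > 0" "1 + 2 * \<delta> > 0"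
    using \<open>\<delta> > 0\<close> by auto
  show ?thesis
    using E [OF u(1)] E [OF u(2)] E [OF u(3)] int [OF u(1)] int [OF u(2)] int [OF u(3)] big cpos
  proof eventually_elim
    case (elim n)
    define q where "q = (c n)\<^sup>2"
    define P where "P = prob {\<omega> \<in> space M. c n \<le> Z n \<omega>}"
    define main where "main = exp (q * ((1 + \<delta>)\<^sup>2 / 2 - \<delta>\<^sup>2 / 8))"
    define err where "err = exp (q * (1 / 2 + \<delta> + \<delta>\<^sup>2 / 8))"
    have "ln 4 \<le> q * (\<delta>\<^sup>2 / 4)"
      using elim(7) \<open>\<delta> > 0\<close> by (simp add: q_def field_simps)
    then have "exp (ln 4) \<le> exp (q * (\<delta>\<^sup>2 / 4))"
      by (simp only: exp_le_cancel_iff)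
    then have four: "4 \<le> exp (q * (\<delta>\<^sup>2 / 4))"
      by simp
    have "main \<le> E (1 + \<delta>) n"
      using elim(2) by (simp add: main_def q_def)
    also have "\<dots> \<le> exp (q * ((1 + \<delta>) * (1 + 2 * \<delta>))) * P + exp (q * \<delta>) * E 1 n
        + exp (- (q * (\<delta> * (1 + 2 * \<delta>)))) * E (1 + 2 * \<delta>) n"
      unfolding E_def P_def q_def
      using elim \<open>\<delta> > 0\<close> by (intro expectation_tilt_window_bound meas) auto
    also have "exp (q * \<delta>) * E 1 n \<le> exp (q * \<delta>) * exp (q * (1\<^sup>2 / 2 + \<delta>\<^sup>2 / 8))"
      using elim(1) by (intro mult_left_mono) (auto simp: q_def)
    also have "\<dots> = err"
      by (simp add: err_def exp_add [symmetric] algebra_simps)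
    also have "exp (- (q * (\<delta> * (1 + 2 * \<delta>)))) * E (1 + 2 * \<delta>) n
        \<le> exp (- (q * (\<delta> * (1 + 2 * \<delta>)))) * exp (q * ((1 + 2 * \<delta>)\<^sup>2 / 2 + \<delta>\<^sup>2 / 8))"
      using elim(3) by (intro mult_left_mono) (auto simp: q_def)
    also have "\<dots> = err"
      by (simp add: err_def exp_add [symmetric] algebra_simps power2_eq_square add_divide_distrib)
    finally have 1: "main \<le> exp (q * ((1 + \<delta>) * (1 + 2 * \<delta>))) * P + err + err"
      by simp
    have "main = exp (q * (\<delta>\<^sup>2 / 4)) * err"
      by (simp add: main_def err_def exp_add [symmetric] algebra_simps power2_eq_square
          add_divide_distrib)
    then have "4 * err \<le> main"
      using four by (simp add: err_def)
    with 1 have 2: "main \<le> 2 * exp (q * ((1 + \<delta>) * (1 + 2 * \<delta>))) * P"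
      by linarith
    define B where "B = exp (q * (- 1 / 2 - 2 * \<delta> - 2 * \<delta>\<^sup>2))"
    define C where "C = exp (q * ((1 + \<delta>) * (1 + 2 * \<delta>)))"
    have "B > 0" "C > 0"
      by (simp_all add: B_def C_def)
    have "(- 1 / 2 - 2 * \<delta> - 2 * \<delta>\<^sup>2) + (1 + \<delta>) * (1 + 2 * \<delta>) + \<delta>\<^sup>2 / 4
        \<le> (1 + \<delta>)\<^sup>2 / 2 - \<delta>\<^sup>2 / 8"
      by (simp add: algebra_simps power2_eq_square add_divide_distrib)
    then have "q * (- 1 / 2 - 2 * \<delta> - 2 * \<delta>\<^sup>2) + q * ((1 + \<delta>) * (1 + 2 * \<delta>)) + q * (\<delta>\<^sup>2 / 4)
        \<le> q * ((1 + \<delta>)\<^sup>2 / 2 - \<delta>\<^sup>2 / 8)"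
      unfolding distrib_left [symmetric] by (intro mult_left_mono) (auto simp: q_def)
    then have 3: "B * C * exp (q * (\<delta>\<^sup>2 / 4)) \<le> main"
      by (simp add: main_def B_def C_def exp_add [symmetric])
    have "2 * C * B \<le> B * C * exp (q * (\<delta>\<^sup>2 / 4))"
      using four \<open>B > 0\<close> \<open>C > 0\<close> mult_left_mono [of 2 "exp (q * (\<delta>\<^sup>2 / 4))" "B * C"]
      by (simp add: mult_ac)
    also note 3
    also have "main \<le> 2 * C * P"
      using 2 by (simp only: C_def)
    finally have "B \<le> P"
      using \<open>C > 0\<close> by simp
    then show ?case
      by (simp add: B_def P_def q_def)
  qed
qed

text \<open>
  The Gaertner--Ellis theorem for the Gaussian rate function, at the single level 1 and with the
  speed \<open>c\<^sub>n\<^sup>2\<close>.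
\<close>

theorem tail_of_quadratic_log_mgf:
  fixes Z :: "nat \<Rightarrow> 'a \<Rightarrow> real" and c :: "nat \<Rightarrow> real"
  assumes meas: "\<And>n. Z n \<in> borel_measurable M"
    and c: "filterlim c at_top sequentially"
    and int: "\<And>u. u > 0 \<Longrightarrow> \<forall>\<^sub>F n in sequentially. integrable M (\<lambda>\<omega>. exp (u * c n * Z n \<omega>))"
    and lim: "\<And>u. u > 0 \<Longrightarrow>
      (\<lambda>n. ln (expectation (\<lambda>\<omega>. exp (u * c n * Z n \<omega>))) / (c n)\<^sup>2) \<longlonglongrightarrow> u\<^sup>2 / 2"
  shows "(\<lambda>n. ln (prob {\<omega> \<in> space M. c n \<le> Z n \<omega>}) / (c n)\<^sup>2) \<longlonglongrightarrow> - 1 / 2"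
proof (rule order_tendstoI)
  let ?P = "\<lambda>n. prob {\<omega> \<in> space M. c n \<le> Z n \<omega>}"
  have cpos: "\<forall>\<^sub>F n in sequentially. c n > 0"
    using c by (simp add: filterlim_at_top_dense)
  have lower: "\<forall>\<^sub>F n in sequentially. exp ((c n)\<^sup>2 * (- 1 / 2 - 2 * \<delta> - 2 * \<delta>\<^sup>2)) \<le> ?P n"
    if "\<delta> > 0" for \<delta>
    using meas c int lim that by (rule tail_lower_bound_of_quadratic_log_mgf)
  {
    fix a :: real assume a: "a < - 1 / 2"
    have "((\<lambda>\<delta>::real. - 1 / 2 - 2 * \<delta> - 2 * \<delta>\<^sup>2) \<longlongrightarrow> - 1 / 2 - 2 * 0 - 2 * 0\<^sup>2) (at_right 0)"
      by (intro tendsto_intros)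
    then have "\<forall>\<^sub>F \<delta> in at_right 0. a < - 1 / 2 - 2 * \<delta> - 2 * \<delta>\<^sup>2"
      using a by (intro order_tendstoD) auto
    then have "\<forall>\<^sub>F \<delta>::real in at_right 0. a < - 1 / 2 - 2 * \<delta> - 2 * \<delta>\<^sup>2 \<and> \<delta> > 0"
      using eventually_at_right_less [of 0] by eventually_elim simp
    then obtain \<delta> :: real where \<delta>: "a < - 1 / 2 - 2 * \<delta> - 2 * \<delta>\<^sup>2" "\<delta> > 0"
      using eventually_happens trivial_limit_at_right_real by blast
    show "\<forall>\<^sub>F n in sequentially. a < ln (?P n) / (c n)\<^sup>2"
      using lower [OF \<delta>(2)] cpos
    proof eventually_elim
      case (elim n)
      then have "?P n > 0"
        by (meson exp_gt_zero less_le_trans)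
      with elim(1) have "(c n)\<^sup>2 * (- 1 / 2 - 2 * \<delta> - 2 * \<delta>\<^sup>2) \<le> ln (?P n)"
        by (simp add: ln_ge_iff)
      then have "- 1 / 2 - 2 * \<delta> - 2 * \<delta>\<^sup>2 \<le> ln (?P n) / (c n)\<^sup>2"
        using elim(2) by (simp add: pos_le_divide_eq mult.commute)
      with \<delta>(1) show ?case
        by linarith
    qed
  }
  {
    fix a :: real assume a: "- 1 / 2 < a"
    have "\<forall>\<^sub>F n in sequentially.
        ln (expectation (\<lambda>\<omega>. exp (1 * c n * Z n \<omega>))) / (c n)\<^sup>2 < a + 1"
      using lim [of 1] a by (intro order_tendstoD) auto
    then show "\<forall>\<^sub>F n in sequentially. ln (?P n) / (c n)\<^sup>2 < a"
      using int [OF zero_less_one] lower [OF zero_less_one] cpos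
    proof eventually_elim
      case (elim n)
      \<comment> \<open>Since \<open>ln 0 = 0\<close>, monotonicity of \<open>ln\<close> needs positivity; it comes from the lower bound.\<close>
      then have P: "?P n > 0"
        by (meson exp_gt_zero less_le_trans)
      have E: "expectation (\<lambda>\<omega>. exp (1 * c n * Z n \<omega>)) > 0"
        using elim(2) by (rule expectation_exp_pos)
      have "ln (?P n) \<le> ln (exp (- (c n)\<^sup>2) * expectation (\<lambda>\<omega>. exp (1 * c n * Z n \<omega>)))"
        using P chernoff_at_level [OF meas elim(4,2)] by (rule ln_mono [rotated -1])
      also have "\<dots> = - (c n)\<^sup>2 + ln (expectation (\<lambda>\<omega>. exp (1 * c n * Z n \<omega>)))"
        using E by (subst ln_mult) auto
      also have "\<dots> < - (c n)\<^sup>2 + (a + 1) * (c n)\<^sup>2"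
        using elim(1,4) by (simp add: pos_divide_less_eq)
      also have "\<dots> = a * (c n)\<^sup>2"
        by (simp add: algebra_simps)
      finally show ?case
        using elim(4) by (simp add: pos_divide_less_eq)
    qed
  }
qed

end

section \<open>Application to scaled integrals of the process\<close>

lemma L2_norm_pos:
  assumes cont: "continuous_on UNIV f" and supp: "compactly_supported f" and "f t \<noteq> 0"
  shows "L2_norm f > 0"
proof -
  let ?K = "closure {t. f t \<noteq> 0}"
  have "set_integrable lborel ?K (\<lambda>t. (f t)\<^sup>2)"
    unfolding set_integrable_def using supp
    by (intro borel_integrable_compact continuous_intros continuous_on_subset [OF cont])
      (auto simp: compactly_supported_def)
  moreover have "indicator ?K t *\<^sub>R (f t)\<^sup>2 = (f t)\<^sup>2" for t
    using closure_subset [of "{t. f t \<noteq> 0}"] by (auto simp: indicator_def)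
  ultimately have int: "integrable lborel (\<lambda>t. (f t)\<^sup>2)"
    by (simp only: set_integrable_def)
  have "(LINT t|lborel. (f t)\<^sup>2) \<noteq> 0"
  proof
    assume "(LINT t|lborel. (f t)\<^sup>2) = 0"
    then have "AE t in lborel. f t = 0"
      using integral_nonneg_eq_0_iff_AE [OF int] by simp
    then have "AE t in lebesgue. t \<in> {t. f t = 0}"
      by (simp add: AE_completion)
    moreover have "closed {t. f t = 0}"
      using cont by (intro closed_Collect_eq) auto
    ultimately have "t \<in> {t. f t = 0}"
      by (intro mem_closed_if_AE_lebesgue)
    with \<open>f t \<noteq> 0\<close> show False
      by simp
  qed
  moreover have "(LINT t|lborel. (f t)\<^sup>2) \<ge> 0"
    by (rule integral_nonneg_AE) simp
  ultimately have "(LINT t|lborel. (f t)\<^sup>2) > 0"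
    by linarith
  then show ?thesis
    by (simp add: L2_norm_def)
qed

lemma scaled_integral_measurable:
  assumes X: "random_process M X" and cont: "continuous_on UNIV g"
  shows "scaled_integral X g r \<in> borel_measurable M"
proof -
  have [measurable]: "(\<lambda>(t, \<omega>). X t \<omega>) \<in> borel_measurable (borel \<Otimes>\<^sub>M M)"
    using X by (simp add: random_process_def)
  have [measurable]: "g \<in> borel_measurable borel"
    using cont by (rule borel_measurable_continuous_onI)
  have "(\<lambda>p. (\<lambda>(t, \<omega>). X t \<omega>) (snd p, fst p)) \<in> borel_measurable (M \<Otimes>\<^sub>M lborel)"
    by measurable
  then have [measurable]: "(\<lambda>p. X (snd p) (fst p)) \<in> borel_measurable (M \<Otimes>\<^sub>M lborel)"
    by simp
  have "(\<lambda>\<omega>. LINT t|lborel. g (t / r) * X t \<omega>) \<in> borel_measurable M"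
    by (intro lborel.borel_measurable_lebesgue_integral) (simp add: split_beta')
  then show ?thesis
    unfolding scaled_integral_def [abs_def] .
qed

lemma log_mgf_limit_sequentially:
  assumes lim: "log_mgf_limit M X g L"
    and r: "filterlim r at_top sequentially"
    and \<theta>: "\<forall>\<^sub>F n in sequentially. \<theta> n \<noteq> 0"
    and small: "(\<lambda>n. \<bar>\<theta> n\<bar> * ln (r n)) \<longlonglongrightarrow> 0"
  shows "\<forall>\<^sub>F n in sequentially. integrable M (\<lambda>\<omega>. exp (\<theta> n * scaled_integral X g (r n) \<omega>))"
    and "(\<lambda>n. 1 / (r n * (\<theta> n)\<^sup>2) *
            ln (LINT \<omega>|M. exp (\<theta> n * scaled_integral X g (r n) \<omega>))) \<longlonglongrightarrow> L"
proof -
  have *: "\<forall>\<^sub>F n in sequentially.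
      integrable M (\<lambda>\<omega>. exp (\<theta> n * scaled_integral X g (r n) \<omega>)) \<and>
      \<bar>1 / (r n * (\<theta> n)\<^sup>2) * ln (LINT \<omega>|M. exp (\<theta> n * scaled_integral X g (r n) \<omega>)) - L\<bar> < \<epsilon>"
    if eps: "\<epsilon> > 0" for \<epsilon>
  proof -
    obtain R \<delta> where "\<delta> > 0" and *: "\<forall>r \<theta>. r > 0 \<longrightarrow> r \<ge> R \<longrightarrow> \<theta> \<noteq> 0 \<longrightarrow> \<bar>\<theta>\<bar> * ln r \<le> \<delta> \<longrightarrow>
        integrable M (\<lambda>\<omega>. exp (\<theta> * scaled_integral X g r \<omega>)) \<and>
        \<bar>1 / (r * \<theta>\<^sup>2) * ln (LINT \<omega>|M. exp (\<theta> * scaled_integral X g r \<omega>)) - L\<bar> < \<epsilon>"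
      using lim [unfolded log_mgf_limit_def, rule_format, OF eps] by (elim exE conjE)
    have "\<forall>\<^sub>F n in sequentially. \<bar>\<theta> n\<bar> * ln (r n) < \<delta>"
      using small \<open>\<delta> > 0\<close> by (rule order_tendstoD)
    moreover have "\<forall>\<^sub>F n in sequentially. r n > 0"
      using r by (simp add: filterlim_at_top_dense)
    moreover have "\<forall>\<^sub>F n in sequentially. r n \<ge> R"
      using r by (simp add: filterlim_at_top)
    ultimately show ?thesis
      using \<theta> by eventually_elim (rule * [rule_format], auto)
  qed
  show "\<forall>\<^sub>F n in sequentially. integrable M (\<lambda>\<omega>. exp (\<theta> n * scaled_integral X g (r n) \<omega>))"
    using * [OF zero_less_one] by eventually_elim simp
  show "(\<lambda>n. 1 / (r n * (\<theta> n)\<^sup>2) *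
      ln (LINT \<omega>|M. exp (\<theta> n * scaled_integral X g (r n) \<omega>))) \<longlonglongrightarrow> L"
  proof (rule tendstoI)
    fix \<epsilon> :: real assume "\<epsilon> > 0"
    from * [OF this] show "\<forall>\<^sub>F n in sequentially. dist (1 / (r n * (\<theta> n)\<^sup>2) *
        ln (LINT \<omega>|M. exp (\<theta> n * scaled_integral X g (r n) \<omega>))) L < \<epsilon>"
      by eventually_elim (simp only: dist_real_def)
  qed
qed

theorem corollary3:
  fixes M :: "'w measure" and X :: "real \<Rightarrow> 'w \<Rightarrow> real"
    and \<sigma> :: real and f :: "real \<Rightarrow> real"
  assumes "splittable TYPE('v) M X"
    and "\<sigma> \<ge> 0"
    and "\<And>g. continuous_on UNIV g \<Longrightarrow> compactly_supported g \<Longrightarrow>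
           log_mgf_limit M X g (\<sigma>\<^sup>2 / 2 * (L2_norm g)\<^sup>2)"
    and "\<sigma> \<noteq> 0"
    and "continuous_on UNIV f" and "compactly_supported f" and "\<exists>t. f t \<noteq> 0"
  shows "\<forall>r c :: nat \<Rightarrow> real.
           filterlim r at_top sequentially \<longrightarrow>
           filterlim c at_top sequentially \<longrightarrow>
           (\<lambda>n. (c n * ln (r n))\<^sup>2 / r n) \<longlonglongrightarrow> 0 \<longrightarrow>
           (\<lambda>n. 1 / (c n)\<^sup>2 *
              ln (measure M {\<omega> \<in> space M.
                scaled_integral X f (r n) \<omega> \<ge> c n * \<sigma> * L2_norm f * sqrt (r n)}))
           \<longlonglongrightarrow> - 1 / 2"
proof (intro allI impI)
  fix r c :: "nat \<Rightarrow> real"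
  assume r: "filterlim r at_top sequentially" and c: "filterlim c at_top sequentially"
    and small: "(\<lambda>n. (c n * ln (r n))\<^sup>2 / r n) \<longlonglongrightarrow> 0"
  have X: "random_process M X"
    using assms(1) by (simp add: splittable_def)
  then interpret prob_space M
    by (simp add: random_process_def)
  define s where "s = \<sigma> * L2_norm f"
  have "s > 0"
    using assms L2_norm_pos by (auto simp: s_def)
  define Z where "Z n \<omega> = scaled_integral X f (r n) \<omega> / (s * sqrt (r n))" for n \<omega>
  have rpos: "\<forall>\<^sub>F n in sequentially. r n > 0" and cpos: "\<forall>\<^sub>F n in sequentially. c n > 0"
    using r c by (simp_all add: filterlim_at_top_dense)
  have rge: "\<forall>\<^sub>F n in sequentially. r n \<ge> 1"
    using r by (simp add: filterlim_at_top)
  have mgf: "log_mgf_limit M X f (s\<^sup>2 / 2)"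
    using assms(3) [OF assms(5,6)] by (simp add: s_def power_mult_distrib)
  have "(\<lambda>n. sqrt ((c n * ln (r n))\<^sup>2 / r n)) \<longlonglongrightarrow> sqrt 0"
    using small by (rule tendsto_real_sqrt)
  then have small': "(\<lambda>n. \<bar>c n * ln (r n)\<bar> / sqrt (r n)) \<longlonglongrightarrow> 0"
    by (simp add: real_sqrt_divide)
  have admissible: "(\<lambda>n. \<bar>u * c n / (s * sqrt (r n))\<bar> * ln (r n)) \<longlonglongrightarrow> 0" if "u > 0" for u
  proof (rule Lim_transform_eventually)
    show "(\<lambda>n. (u / s) * (\<bar>c n * ln (r n)\<bar> / sqrt (r n))) \<longlonglongrightarrow> 0"
      using small' by (rule tendsto_mult_right_zero)
    show "\<forall>\<^sub>F n in sequentially. (u / s) * (\<bar>c n * ln (r n)\<bar> / sqrt (r n))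
        = \<bar>u * c n / (s * sqrt (r n))\<bar> * ln (r n)"
      using rge cpos by eventually_elim (use that \<open>s > 0\<close> in \<open>simp add: abs_mult\<close>)
  qed
  have nz: "\<forall>\<^sub>F n in sequentially. u * c n / (s * sqrt (r n)) \<noteq> 0" if "u > 0" for u
    using rpos cpos by eventually_elim (use that \<open>s > 0\<close> in simp)
  have exponent: "u * c n / (s * sqrt (r n)) * scaled_integral X f (r n) \<omega> = u * c n * Z n \<omega>"
    for u n \<omega>
    by (simp add: Z_def)
  note seq = log_mgf_limit_sequentially [OF mgf r nz admissible, unfolded exponent]
  have "(\<lambda>n. ln (prob {\<omega> \<in> space M. c n \<le> Z n \<omega>}) / (c n)\<^sup>2) \<longlonglongrightarrow> - 1 / 2"
  proof (rule tail_of_quadratic_log_mgf)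
    show "Z n \<in> borel_measurable M" for n
      using scaled_integral_measurable [OF X assms(5), of "r n"] unfolding Z_def by measurable
  next
    fix u :: real assume u: "u > 0"
    show "\<forall>\<^sub>F n in sequentially. integrable M (\<lambda>\<omega>. exp (u * c n * Z n \<omega>))"
      using u u by (rule seq(1))
    show "(\<lambda>n. ln (expectation (\<lambda>\<omega>. exp (u * c n * Z n \<omega>))) / (c n)\<^sup>2) \<longlonglongrightarrow> u\<^sup>2 / 2"
    proof (rule Lim_transform_eventually)
      have "(\<lambda>n. (u\<^sup>2 / s\<^sup>2) * (1 / (r n * (u * c n / (s * sqrt (r n)))\<^sup>2) *
          ln (expectation (\<lambda>\<omega>. exp (u * c n * Z n \<omega>))))) \<longlonglongrightarrow> (u\<^sup>2 / s\<^sup>2) * (s\<^sup>2 / 2)"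
        using seq(2) [OF u u] by (rule tendsto_mult_left)
      then show "(\<lambda>n. (u\<^sup>2 / s\<^sup>2) * (1 / (r n * (u * c n / (s * sqrt (r n)))\<^sup>2) *
          ln (expectation (\<lambda>\<omega>. exp (u * c n * Z n \<omega>))))) \<longlonglongrightarrow> u\<^sup>2 / 2"
        using \<open>s > 0\<close> by simp
      show "\<forall>\<^sub>F n in sequentially. (u\<^sup>2 / s\<^sup>2) * (1 / (r n * (u * c n / (s * sqrt (r n)))\<^sup>2) *
          ln (expectation (\<lambda>\<omega>. exp (u * c n * Z n \<omega>))))
          = ln (expectation (\<lambda>\<omega>. exp (u * c n * Z n \<omega>))) / (c n)\<^sup>2"
        using rpos cpos
        by eventually_elim
          (use u \<open>s > 0\<close> in \<open>simp add: power_mult_distrib power_divide\<close>)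
    qed
  qed (rule c)
  moreover have "\<forall>\<^sub>F n in sequentially. ln (prob {\<omega> \<in> space M. c n \<le> Z n \<omega>}) / (c n)\<^sup>2
      = 1 / (c n)\<^sup>2 * ln (measure M {\<omega> \<in> space M.
          scaled_integral X f (r n) \<omega> \<ge> c n * \<sigma> * L2_norm f * sqrt (r n)})"
    using rpos
  proof eventually_elim
    case (elim n)
    then have "s * sqrt (r n) > 0"
      using \<open>s > 0\<close> by simp
    then have "c n \<le> Z n \<omega> \<longleftrightarrow> c n * \<sigma> * L2_norm f * sqrt (r n) \<le> scaled_integral X f (r n) \<omega>"
      for \<omega>
      by (simp only: Z_def pos_le_divide_eq) (simp add: s_def mult_ac)
    then show ?case
      by simp
  qed
  ultimately show "(\<lambda>n. 1 / (c n)\<^sup>2 * ln (measure M {\<omega> \<in> space M.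
      scaled_integral X f (r n) \<omega> \<ge> c n * \<sigma> * L2_norm f * sqrt (r n)})) \<longlonglongrightarrow> - 1 / 2"
    by (rule Lim_transform_eventually)
qed

end
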